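(* Let $p(z)=\sum_{j=0}^{n}a_jz^j$, with $a_0\neq 0$, be a polynomial of degree $n$ with complex coefficients, and write $\alpha_j=\operatorname{Re}(a_j)$ and $\beta_j=\operatorname{Im}(a_j)$ for $0\le j\le n$. Suppose that $$\alpha_{n}\leq \alpha_{n-1}\leq \cdots\leq\alpha_{0}.$$ Then for every $\delta$ with $0<\delta<1$, the number of zeros of $p$ in the disk $|z|\leq\delta$ does not exceed $$\frac{1}{\log (1/\delta)}\log\frac{M_1}{|a_0|},$$ where $$M_1=|\alpha_0|+\alpha_0+|\alpha_n|-\alpha_n+2\sum_{j=0}^{n}|\beta_j|.$$
   Context: Zeros are counted with multiplicity. *)

theory Defs
  imports "HOL-Complex_Analysis.Complex_Analysis" "HOL-Computational_Algebra.Computational_Algebra"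
begin

end

theory Submission
  imports Defs
begin

text \<open>
  The zeros in the disk are counted by Jensen's inequality: a polynomial \<open>f\<close> that is bounded by
  \<open>M\<close> on the unit circle and has \<open>N\<close> zeros of modulus at most \<open>\<delta> < 1\<close> satisfies
  \<open>\<bar>f(0)\<bar> \<le> M \<delta>\<^sup>N\<close>.  Indeed, replacing each factor \<open>z - w\<close> that belongs to such a zero by
  \<open>1 - cnj w * z\<close> leaves the modulus on the unit circle unchanged, so by the maximum modulus
  principle the new polynomial is bounded by \<open>M\<close> at the origin as well; and \<open>f(0)\<close> is, up to
  sign, its value there times the product of the \<open>N\<close> zeros.  Taking logarithms turns this into
  an upper bound for \<open>N\<close>.

  Applied to \<open>p\<close> itself, this would lead to a bound with \<open>\<Sum> \<bar>a\<^sub>j\<bar>\<close>.  Monotonicity of the real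
  parts is exploited by passing to \<open>(1 - z) p(z)\<close>: the extra zero at \<open>1\<close> lies outside the disk of
  radius \<open>\<delta>\<close>, the value at \<open>0\<close> does not change, and the coefficients become the differences
  \<open>a\<^sub>j - a\<^sub>j\<^sub>-\<^sub>1\<close>, whose real parts have a constant sign and therefore telescope when their absolute
  values are added.  This gives the bound \<open>M1\<close> on the unit circle.
\<close>

section \<open>Jensen's inequality for polynomials\<close>

text \<open>
  Since \<open>1 / z = cnj z\<close> on the unit circle, both sides are the modulus of \<open>cnj (z - w)\<close>.  This is
  why Blaschke factors are unimodular there.
\<close>

lemma norm_one_minus_cnj_mult:
  assumes "cmod z = 1"
  shows "cmod (1 - cnj w * z) = cmod (z - w)"
proof -
  have "z * cnj z = 1"
    using assms by (simp add: complex_norm_square[symmetric])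
  then have "1 - cnj w * z = z * cnj (z - w)"
    by (simp add: algebra_simps)
  then show ?thesis
    using assms by (simp only: norm_mult complex_mod_cnj)
qed

text \<open>
  The polynomial obtained from \<open>(\<Prod>w\<in>#A. [:- w, 1:]) * q\<close> by reflecting the zeros in \<open>A\<close> at the
  unit circle takes the value \<open>q(0)\<close> at the origin, so the maximum modulus principle bounds the
  cofactor \<open>q\<close> there.
\<close>

lemma norm_poly_cofactor_0_le:
  fixes q :: "complex poly"
  assumes bound: "\<And>z. cmod z = 1 \<Longrightarrow> cmod (poly ((\<Prod>w\<in>#A. [:- w, 1:]) * q) z) \<le> M"
  shows "cmod (poly q 0) \<le> M"
proof -
  define g where "g = (\<Prod>w\<in>#A. [:1, - cnj w:]) * q"
  have swap: "cmod (poly (\<Prod>w\<in>#A. [:1, - cnj w:]) z) = cmod (poly (\<Prod>w\<in>#A. [:- w, 1:]) z)"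
    if "cmod z = 1" for z
  proof (induction A)
    case (add w A)
    then show ?case
      using norm_one_minus_cnj_mult[OF that, of w]
      by (simp add: norm_mult mult.commute del: mult_pCons_left)
  qed simp
  have "cmod (poly g 0) \<le> M"
  proof (rule maximum_modulus_frontier[where f = "poly g" and S = "cball 0 1"])
    show "cmod (poly g z) \<le> M" if "z \<in> frontier (cball 0 1)" for z
      using that bound[of z] swap[of z] by (simp add: g_def norm_mult)
  qed (auto intro!: holomorphic_intros continuous_intros)
  moreover have "poly (\<Prod>w\<in>#A. [:1, - cnj w:]) 0 = 1"
    by (induction A) (simp_all del: mult_pCons_left)
  ultimately show ?thesis
    by (simp add: g_def)
qed

lemma norm_poly_prod_mset_linear_0_le:
  fixes A :: "complex multiset"
  assumes "\<And>w. w \<in># A \<Longrightarrow> cmod w \<le> \<delta>" and "0 \<le> \<delta>"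
  shows "cmod (poly (\<Prod>w\<in>#A. [:- w, 1:]) 0) \<le> \<delta> ^ size A"
  using assms(1)
proof (induction A)
  case (add w A)
  then show ?case
    using \<open>0 \<le> \<delta>\<close> by (auto simp: norm_mult intro!: mult_mono simp del: mult_pCons_left)
qed simp

theorem Jensen_inequality_poly:
  fixes f :: "complex poly"
  assumes bound: "\<And>z. cmod z = 1 \<Longrightarrow> cmod (poly f z) \<le> M" and "0 \<le> \<delta>"
  shows "cmod (poly f 0) \<le> M * \<delta> ^ size {#z \<in># proots f. cmod z \<le> \<delta>#}"
proof -
  define A where "A = {#z \<in># proots f. cmod z \<le> \<delta>#}"
  define B where "B = {#z \<in># proots f. \<not> cmod z \<le> \<delta>#}"
  define q where "q = smult (lead_coeff f) (\<Prod>w\<in>#B. [:- w, 1:])"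
  have "proots f = A + B"
    unfolding A_def B_def by (rule multiset_partition)
  then have f: "f = (\<Prod>w\<in>#A. [:- w, 1:]) * q"
    using complex_poly_decompose_multiset[of f] by (simp add: q_def)
  have "cmod (poly q 0) \<le> M"
    using bound by (intro norm_poly_cofactor_0_le[of A]) (simp flip: f)
  moreover have "cmod (poly (\<Prod>w\<in>#A. [:- w, 1:]) 0) \<le> \<delta> ^ size A"
    using \<open>0 \<le> \<delta>\<close> by (intro norm_poly_prod_mset_linear_0_le) (auto simp: A_def)
  moreover have "poly f 0 = poly q 0 * poly (\<Prod>w\<in>#A. [:- w, 1:]) 0"
    by (subst f) simp
  ultimately show ?thesis
    using order_trans[OF norm_ge_zero] \<open>0 \<le> \<delta>\<close>
    by (auto simp: A_def[symmetric] norm_mult intro!: mult_mono)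
qed

corollary count_zeros_le_log:
  fixes f :: "complex poly"
  assumes bound: "\<And>z. cmod z = 1 \<Longrightarrow> cmod (poly f z) \<le> M"
    and f0: "poly f 0 \<noteq> 0" and \<delta>: "0 < \<delta>" "\<delta> < 1"
  shows "real (size {#z \<in># proots f. cmod z \<le> \<delta>#}) \<le> 1 / ln (1 / \<delta>) * ln (M / cmod (poly f 0))"
proof -
  define N where "N = size {#z \<in># proots f. cmod z \<le> \<delta>#}"
  have le: "cmod (poly f 0) \<le> M * \<delta> ^ N"
    unfolding N_def using bound \<delta> by (intro Jensen_inequality_poly) auto
  then have "0 < M * \<delta> ^ N"
    using f0 by (intro less_le_trans[OF _ le]) simp
  then have "0 < M"
    using \<delta> by (simp add: zero_less_mult_iff)
  have "(1 / \<delta>) ^ N \<le> M / cmod (poly f 0)"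
    using le \<delta> f0 by (simp add: field_simps)
  then have "ln ((1 / \<delta>) ^ N) \<le> ln (M / cmod (poly f 0))"
    using \<delta> f0 \<open>0 < M\<close> by (subst ln_le_cancel_iff) auto
  then have "real N * ln (1 / \<delta>) \<le> ln (M / cmod (poly f 0))"
    using \<delta> by (simp add: ln_realpow)
  moreover have "0 < ln (1 / \<delta>)"
    using \<delta> by simp
  ultimately show ?thesis
    unfolding N_def by (simp add: pos_le_divide_eq)
qed

section \<open>Coefficients with decreasing real parts\<close>

lemma one_minus_mult_power_sum:
  fixes a :: "nat \<Rightarrow> 'a::comm_ring_1"
  shows "(1 - z) * (\<Sum>j\<le>n. a j * z ^ j)
       = a 0 + (\<Sum>j<n. (a (Suc j) - a j) * z ^ Suc j) - a n * z ^ Suc n"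
  by (induction n) (simp_all add: algebra_simps)

lemma sum_adjacent_pairs:
  fixes b :: "nat \<Rightarrow> 'a::comm_ring_1"
  shows "b 0 + (\<Sum>j<n. b (Suc j) + b j) + b n = 2 * (\<Sum>j\<le>n. b j)"
  by (induction n) (simp_all add: algebra_simps)

text \<open>
  The real parts of the differences telescope to \<open>Re (a 0) - Re (a n)\<close>, because they all have the
  same sign; each imaginary part is counted twice, once for each of the two differences in which
  it occurs (the two end coefficients supply the missing occurrences of \<open>Im (a 0)\<close> and \<open>Im (a n)\<close>).
\<close>

lemma norm_one_minus_mult_power_sum_le:
  fixes a :: "nat \<Rightarrow> complex"
  assumes decr: "\<And>j. j < n \<Longrightarrow> Re (a (Suc j)) \<le> Re (a j)" and z: "cmod z = 1"
  shows "cmod ((1 - z) * (\<Sum>j\<le>n. a j * z ^ j))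
       \<le> \<bar>Re (a 0)\<bar> + Re (a 0) + \<bar>Re (a n)\<bar> - Re (a n) + 2 * (\<Sum>j\<le>n. \<bar>Im (a j)\<bar>)"
proof -
  have "cmod ((1 - z) * (\<Sum>j\<le>n. a j * z ^ j))
      \<le> cmod (a 0) + cmod (\<Sum>j<n. (a (Suc j) - a j) * z ^ Suc j) + cmod (a n * z ^ Suc n)"
    unfolding one_minus_mult_power_sum
    by (intro order_trans[OF norm_triangle_ineq4] add_right_mono norm_triangle_ineq)
  also have "cmod (a n * z ^ Suc n) = cmod (a n)"
    using z by (simp add: norm_mult norm_power)
  also have "cmod (\<Sum>j<n. (a (Suc j) - a j) * z ^ Suc j)
      \<le> (\<Sum>j<n. (Re (a j) - Re (a (Suc j))) + (\<bar>Im (a (Suc j))\<bar> + \<bar>Im (a j)\<bar>))"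
  proof (rule sum_norm_le)
    fix j assume "j \<in> {..<n}"
    then have "Re (a (Suc j)) \<le> Re (a j)"
      using decr by simp
    then show "cmod ((a (Suc j) - a j) * z ^ Suc j)
        \<le> (Re (a j) - Re (a (Suc j))) + (\<bar>Im (a (Suc j))\<bar> + \<bar>Im (a j)\<bar>)"
      using z cmod_le[of "a (Suc j) - a j"] by (simp add: norm_mult norm_power)
  qed
  also have "\<dots> = Re (a 0) - Re (a n) + (\<Sum>j<n. \<bar>Im (a (Suc j))\<bar> + \<bar>Im (a j)\<bar>)"
    by (simp only: sum.distrib sum_lessThan_telescope'[of "\<lambda>j. Re (a j)"])
  finally show ?thesis
    using cmod_le[of "a 0"] cmod_le[of "a n"] sum_adjacent_pairs[of "\<lambda>j. \<bar>Im (a j)\<bar>" n]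
    by linarith
qed

section \<open>Counting the zeros in a disk\<close>

theorem corollary2:
  fixes p :: "complex poly" and n :: nat and a :: "nat \<Rightarrow> complex"
    and \<alpha> \<beta> :: "nat \<Rightarrow> real" and \<delta> M1 :: real
  assumes "p = (\<Sum>j\<le>n. monom (a j) j)"
    and "degree p = n"
    and "a 0 \<noteq> 0"
    and "\<And>j. j \<le> n \<Longrightarrow> \<alpha> j = Re (a j)"
    and "\<And>j. j \<le> n \<Longrightarrow> \<beta> j = Im (a j)"
    and "\<And>j. j < n \<Longrightarrow> \<alpha> (Suc j) \<le> \<alpha> j"
    and "M1 = \<bar>\<alpha> 0\<bar> + \<alpha> 0 + \<bar>\<alpha> n\<bar> - \<alpha> n + 2 * (\<Sum>j=0..n. \<bar>\<beta> j\<bar>)"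
    and "0 < \<delta>" and "\<delta> < 1"
  shows "real (size {#z \<in># proots p. cmod z \<le> \<delta>#}) \<le> 1 / ln (1 / \<delta>) * ln (M1 / cmod (a 0))"
proof -
  define f where "f = [:1, -1:] * p"
  have poly_p: "poly p z = (\<Sum>j\<le>n. a j * z ^ j)" for z
    by (simp add: assms(1) poly_sum poly_monom)
  have p0: "poly p 0 = a 0"
    by (simp add: poly_p power_0_left if_distrib cong: if_cong)
  then have "p \<noteq> 0"
    using assms(3) by auto
  have M1: "M1 = \<bar>Re (a 0)\<bar> + Re (a 0) + \<bar>Re (a n)\<bar> - Re (a n) + 2 * (\<Sum>j\<le>n. \<bar>Im (a j)\<bar>)"
    using assms(4,5,7) by (simp add: atLeast0AtMost)
  have "cmod (poly f z) \<le> M1" if "cmod z = 1" for z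
  proof -
    have "poly f z = (1 - z) * (\<Sum>j\<le>n. a j * z ^ j)"
      by (simp add: f_def poly_p algebra_simps)
    then show ?thesis
      unfolding M1 using assms(4,6) that by (simp add: norm_one_minus_mult_power_sum_le)
  qed
  moreover have f0: "poly f 0 = a 0"
    by (simp add: f_def p0)
  ultimately have "real (size {#z \<in># proots f. cmod z \<le> \<delta>#})
      \<le> 1 / ln (1 / \<delta>) * ln (M1 / cmod (a 0))"
    using count_zeros_le_log[of f M1 \<delta>] assms(3,8,9) by simp
  moreover have "proots f = add_mset 1 (proots p)"
  proof -
    have "f = - ([:-1, 1:] * p)"
      by (simp add: f_def)
    then show ?thesis
      using \<open>p \<noteq> 0\<close> by (simp add: proots_mult del: mult_pCons_left)
  qed
  ultimately show ?thesis
    using \<open>\<delta> < 1\<close> by simp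
qed

end
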